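(* Let $V\subset\mathbb{R}^{m+n}$ be open with coordinates $(\xi^1,\dots,\xi^{m+n})=(x^1,\dots,x^m,y^1,\dots,y^n)$, and let $F^{ij}:V\to\mathbb{R}$, $1\le i\le n$, $1\le j\le m$, be continuous functions with modulus of continuity $w_1$. Let $\hat F(\xi)$ be the $n\times(m+n)$ matrix with $\hat F^{ij}(\xi)=F^{ij}(\xi)$ for $1\le j\le m$ and $\hat F^{ij}(\xi)=\delta_{i,\,j-m}$ for $m+1\le j\le m+n$. Let $\xi=(x_0,y_0)\in V$ be a point such that for some set of indices $I=(i_1,\dots,i_n)$ the submatrix $\hat F^I(\xi)$ of $\hat F(\xi)$ formed by the columns $i_1,\dots,i_n$ satisfies $\det\hat F^I(\xi)\neq0$. Suppose that all $F^{ij}$ have modulus of continuity $w_2$ with respect to the variables $\{\xi^{i_1},\dots,\xi^{i_n}\}$ and that $$\lim_{s\to0}w_1(s)\,e^{w_2(s)/s}=0.$$ If the PDE $$\frac{\partial y^i}{\partial x^j}=F^{ij}(x,y(x)),\qquad i=1,\dots,n,\ j=1,\dots,m,$$ admits a solution at $\xi$ (i.e. a solution near $x_0$ with $y(x_0)=y_0$), then that solution is unique.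
   Context: Let $w:\mathbb{R}^+\to\mathbb{R}^+$ be an increasing continuous function with $\lim_{s\to0}w(s)=0$. A function $G:U\subset\mathbb{R}^N\to\mathbb{R}^M$ has modulus of continuity $w$ with respect to the variable $\xi^i$ if there is a constant $K>0$ such that for all $(\xi^1,\dots,\xi^N)\in U$ and all $s$ small enough that $(\xi^1,\dots,\xi^i+s,\dots,\xi^N)\in U$, $|G(\xi^1,\dots,\xi^i+s,\dots,\xi^N)-G(\xi^1,\dots,\xi^N)|\le Kw(|s|)$. $G$ has modulus of continuity $w$ if it does so with respect to all variables. The functions $w_1,w_2$ are of this type. Uniqueness means: any two solutions with $y(x_0)=y_0$ coincide on a neighbourhood of $x_0$. *)

theory Defs
  imports "HOL-Analysis.Analysis"
begin

text \<open>
  Here the half-line of admissible arguments and values is read as \<open>[0, \<infinity>)\<close>, since a modulus is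
  also evaluated at increment \<open>0\<close>; the limit condition then forces \<open>w 0 = 0\<close>.  A modulus defined
  only on \<open>(0, \<infinity>)\<close> is covered by setting \<open>w 0 = 0\<close>.  "Increasing" is not required to be strict.
\<close>

definition modulus_function :: "(real \<Rightarrow> real) \<Rightarrow> bool" where
  "modulus_function w \<longleftrightarrow>
     (\<forall>s\<ge>0. w s \<ge> 0) \<and> mono_on {0..} w \<and> continuous_on {0..} w \<and> (w \<longlongrightarrow> 0) (at_right 0)"

definition has_modulus_wrt ::
    "(real \<Rightarrow> real) \<Rightarrow> 'k::finite \<Rightarrow> (real^'k) set \<Rightarrow> (real^'k \<Rightarrow> 'b::real_normed_vector) \<Rightarrow> bool" where
  "has_modulus_wrt w i U G \<longleftrightarrow>
     (\<exists>K>0. \<forall>\<xi>\<in>U. \<forall>s. \<xi> + s *\<^sub>R axis i 1 \<in> U \<longrightarrow>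
        norm (G (\<xi> + s *\<^sub>R axis i 1) - G \<xi>) \<le> K * w \<bar>s\<bar>)"

definition has_modulus ::
    "(real \<Rightarrow> real) \<Rightarrow> (real^'k::finite) set \<Rightarrow> (real^'k \<Rightarrow> 'b::real_normed_vector) \<Rightarrow> bool" where
  "has_modulus w U G \<longleftrightarrow> (\<forall>i. has_modulus_wrt w i U G)"

text \<open>
  The coordinates \<open>(x, y)\<close> of an \<open>(m+n)\<close>-dimensional space are indexed by the sum type
  \<open>'m + 'n\<close>: \<open>Inl j\<close> is the index of \<open>x\<^sup>j\<close> and \<open>Inr i\<close> is the index of \<open>y\<^sup>i\<close>.
\<close>

definition join :: "real^'m::finite \<Rightarrow> real^'n::finite \<Rightarrow> real^('m + 'n)" where
  "join x y = (\<chi> k. case k of Inl j \<Rightarrow> x $ j | Inr i \<Rightarrow> y $ i)"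

definition hat_matrix ::
    "('n::finite \<Rightarrow> 'm::finite \<Rightarrow> real^('m + 'n) \<Rightarrow> real) \<Rightarrow> real^('m + 'n) \<Rightarrow> real^('m + 'n)^'n" where
  "hat_matrix F \<xi> = (\<chi> i k. case k of Inl j \<Rightarrow> F i j \<xi> | Inr l \<Rightarrow> if i = l then 1 else 0)"

definition column_submatrix :: "real^'k^'n \<Rightarrow> ('n \<Rightarrow> 'k) \<Rightarrow> real^'n^'n" where
  "column_submatrix A I = (\<chi> i l. A $ i $ I l)"

text \<open>
  Solutions are differentiable on a neighbourhood of \<open>x0\<close>.  For continuous \<open>F\<close> they are then
  automatically continuously differentiable, as the partial derivatives are \<open>F i j (join x (y x))\<close>.
  The values of \<open>y\<close> outside the neighbourhood \<open>A\<close> are irrelevant.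
\<close>

definition local_solution ::
    "('n::finite \<Rightarrow> 'm::finite \<Rightarrow> real^('m + 'n) \<Rightarrow> real) \<Rightarrow> (real^('m + 'n)) set \<Rightarrow>
     real^'m \<Rightarrow> real^'n \<Rightarrow> (real^'m \<Rightarrow> real^'n) \<Rightarrow> bool" where
  "local_solution F V x0 y0 y \<longleftrightarrow> y x0 = y0 \<and>
     (\<exists>A. open A \<and> x0 \<in> A \<and> y differentiable_on A \<and>
        (\<forall>x\<in>A. join x (y x) \<in> V \<and>
           (\<forall>i j. ((\<lambda>t. y (x + t *\<^sub>R axis j 1) $ i) has_real_derivative F i j (join x (y x))) (at 0))))"

end

theory Submission
  imports Defs
begin

text \<open>
  Unless \<open>F\<close> is locally constant, \<open>w1 s\<close> dominates a multiple of \<open>s\<close>, so the limit hypothesis gives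
  \<open>w2 s \<le> s ln (C / s)\<close>: the functions \<open>F i j\<close> are log-Lipschitz in the coordinates \<open>I\<close>.  As the
  minor is nonzero, the graph of a solution is a graph over the coordinates \<open>J\<close> complementary to \<open>I\<close>.
  Lift a segment in \<open>J\<close>-space to the graphs of two solutions.  The difference \<open>D\<close> of the lifts only has
  \<open>I\<close>-components and \<open>\<bar>D'\<bar> \<le> L \<bar>D\<bar> ln (C / \<bar>D\<bar>)\<close>, with \<open>L\<close> proportional to the length of the
  segment, so \<open>D = 0\<close> by an Osgood argument.
\<close>

section \<open>Coordinatewise moduli of continuity\<close>

lemma has_modulus_wrt_subset:
  "has_modulus_wrt w k V G \<Longrightarrow> U \<subseteq> V \<Longrightarrow> has_modulus_wrt w k U G"
  unfolding has_modulus_wrt_def by (meson subsetD)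

text \<open>Pass from \<open>q\<close> to \<open>p\<close> by changing the coordinates in
  \<open>T\<close> one at a time and add up the steps. The domain is a box because a box, being a
  product of intervals, contains every point that mixes coordinates of \<open>p\<close> and
  \<open>q\<close>.\<close>

lemma norm_diff_le_sum_of_coordinate_steps:
  fixes G :: "real^'k::finite \<Rightarrow> 'b::real_normed_vector" and \<beta> :: "real \<Rightarrow> real"
  assumes step: "\<And>\<xi> k s. k \<in> T \<Longrightarrow> \<xi> \<in> cbox a b \<Longrightarrow> \<xi> + s *\<^sub>R axis k 1 \<in> cbox a b \<Longrightarrow>
      norm (G (\<xi> + s *\<^sub>R axis k 1) - G \<xi>) \<le> \<beta> \<bar>s\<bar>"
    and p: "p \<in> cbox a b" and q: "q \<in> cbox a b" and eq: "\<And>k. k \<notin> T \<Longrightarrow> p $ k = q $ k"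
  shows "norm (G p - G q) \<le> (\<Sum>k\<in>T. \<beta> \<bar>p $ k - q $ k\<bar>)"
proof -
  define mix where "mix A = (\<chi> k. if k \<in> A then p $ k else q $ k)" for A
  have mix_in: "mix A \<in> cbox a b" for A
    using p q by (auto simp: mix_def mem_box_cart)
  have "norm (G (mix A) - G q) \<le> (\<Sum>k\<in>A. \<beta> \<bar>p $ k - q $ k\<bar>)" if "A \<subseteq> T" for A
    using finite[of A] that
  proof (induction A rule: finite_induct)
    case empty
    have "mix {} = q" by (simp add: mix_def vec_eq_iff)
    then show ?case by simp
  next
    case (insert k A)
    have m: "mix (insert k A) = mix A + (p $ k - q $ k) *\<^sub>R axis k 1"
      using insert by (auto simp: mix_def vec_eq_iff axis_def)
    have "norm (G (mix (insert k A)) - G (mix A)) \<le> \<beta> \<bar>p $ k - q $ k\<bar>"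
      unfolding m by (rule step) (use insert mix_in m[symmetric] in auto)
    moreover have "norm (G (mix (insert k A)) - G q)
        \<le> norm (G (mix (insert k A)) - G (mix A)) + norm (G (mix A) - G q)"
      by norm
    ultimately show ?case using insert by auto
  qed
  moreover have "mix T = p" by (simp add: mix_def vec_eq_iff eq)
  ultimately show ?thesis by (metis order_refl)
qed

text \<open>A modulus that is sublinear along a sequence forces a function to be constant:
  a segment can be cut into many short steps.\<close>

lemma modulus_ge_linear:
  fixes G :: "real^'k::finite \<Rightarrow> 'b::real_normed_vector"
  assumes mono: "mono_on {0..} w" and mod: "\<And>k. has_modulus_wrt w k (cbox a b) G"
    and pq: "p \<in> cbox a b" "q \<in> cbox a b" "G p \<noteq> G q"
  obtains c s0 where "c > 0" "s0 > 0" "\<And>s. 0 < s \<Longrightarrow> s \<le> s0 \<Longrightarrow> c * s \<le> w s"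
proof -
  \<comment> \<open>A single coordinate step must already change \<open>G\<close>; otherwise the
    preceding lemma with the bound \<open>0\<close> would give \<open>G p = G q\<close>.\<close>
  have "\<exists>k \<xi> s. \<xi> \<in> cbox a b \<and> \<xi> + s *\<^sub>R axis k 1 \<in> cbox a b \<and> G (\<xi> + s *\<^sub>R axis k 1) \<noteq> G \<xi>"
  proof (rule ccontr)
    assume "\<not> ?thesis"
    then have "norm (G p - G q) \<le> (\<Sum>k\<in>UNIV. (\<lambda>_. 0) \<bar>p $ k - q $ k\<bar>)"
      by (intro norm_diff_le_sum_of_coordinate_steps[where a=a and b=b]) (use pq in auto)
    then show False using pq by simp
  qed
  then obtain k \<xi> s1 where \<xi>: "\<xi> \<in> cbox a b" "\<xi> + s1 *\<^sub>R axis k 1 \<in> cbox a b"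
    and ne: "G (\<xi> + s1 *\<^sub>R axis k 1) \<noteq> G \<xi>" by blast
  obtain K where K: "K > 0" "\<And>\<xi> s. \<xi> \<in> cbox a b \<Longrightarrow> \<xi> + s *\<^sub>R axis k 1 \<in> cbox a b \<Longrightarrow>
      norm (G (\<xi> + s *\<^sub>R axis k 1) - G \<xi>) \<le> K * w \<bar>s\<bar>"
    using mod[of k] unfolding has_modulus_wrt_def by blast
  define f where "f t = G (\<xi> + (t * s1) *\<^sub>R axis k 1)" for t
  have in_box: "\<xi> + (t * s1) *\<^sub>R axis k 1 \<in> cbox a b" if "0 \<le> t" "t \<le> 1" for t
  proof -
    have "(1 - t) *\<^sub>R \<xi> + t *\<^sub>R (\<xi> + s1 *\<^sub>R axis k 1) \<in> cbox a b"
      using convex_box(1)[of a b] \<xi> that unfolding convex_alt by blast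
    then show ?thesis by (simp add: algebra_simps)
  qed
  have d: "norm (f 1 - f 0) > 0" and s1: "\<bar>s1\<bar> > 0" using ne by (auto simp: f_def)
  show thesis
  proof (rule that[of "norm (f 1 - f 0) / (2 * \<bar>s1\<bar> * K)" "\<bar>s1\<bar>"])
    fix s :: real assume s: "0 < s" "s \<le> \<bar>s1\<bar>"
    \<comment> \<open>\<open>N\<close> equal steps across the segment have length at most
      \<open>s\<close>. Since \<open>\<bar>s1\<bar> / s \<ge> 1\<close>, rounding up at most doubles
      the quotient, which explains the 2 in the constant.\<close>
    define N where "N = nat \<lceil>\<bar>s1\<bar> / s\<rceil>"
    have q1: "\<bar>s1\<bar> / s \<ge> 1" using s by simp
    have N1: "real N \<ge> \<bar>s1\<bar> / s" unfolding N_def by (rule real_nat_ceiling_ge)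
    have N2: "real N \<le> 2 * \<bar>s1\<bar> / s"
    proof -
      have "real N \<le> \<bar>s1\<bar> / s + 1" unfolding N_def using q1 by linarith
      then show ?thesis using q1 by simp
    qed
    have N0: "real N > 0" using N1 q1 by linarith
    have short: "\<bar>s1\<bar> / real N \<le> s"
      using N1 N0 s by (simp add: field_simps)
    have step: "norm (f (real (Suc i) / N) - f (real i / N)) \<le> K * w s" if "i < N" for i
    proof -
      have e: "\<xi> + (real (Suc i) / N * s1) *\<^sub>R axis k 1
          = (\<xi> + (real i / N * s1) *\<^sub>R axis k 1) + (s1 / N) *\<^sub>R axis k 1"
        by (simp add: add_divide_distrib algebra_simps)
      have "norm (f (real (Suc i) / N) - f (real i / N)) \<le> K * w \<bar>s1 / N\<bar>"
        unfolding f_def e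
        by (rule K(2)) (use in_box[of "real i / N"] in_box[of "real (Suc i) / N"] that in \<open>simp_all only: e\<close>, simp_all)
      also have "\<dots> \<le> K * w s"
        using K(1) short s by (intro mult_left_mono mono_onD[OF mono]) auto
      finally show ?thesis .
    qed
    have "f 1 - f 0 = (\<Sum>i<N. f (real (Suc i) / N) - f (real i / N))"
      using sum_lessThan_telescope[of "\<lambda>i. f (real i / N)" N] N0 by simp
    also have "norm \<dots> \<le> (\<Sum>i<N. K * w s)" by (intro sum_norm_le step) auto
    also have "\<dots> = real N * (K * w s)" by simp
    finally have b: "norm (f 1 - f 0) \<le> real N * (K * w s)" .
    have "w s \<ge> 0"
    proof (rule ccontr)
      assume "\<not> w s \<ge> 0"
      then have "real N * (K * w s) < 0" using K(1) N0 by (simp add: mult_pos_neg)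
      then show False using b norm_ge_zero[of "f 1 - f 0"] by linarith
    qed
    then have "norm (f 1 - f 0) \<le> 2 * \<bar>s1\<bar> / s * (K * w s)"
      using b mult_right_mono[OF N2, of "K * w s"] K(1) by simp
    then show "norm (f 1 - f 0) / (2 * \<bar>s1\<bar> * K) * s \<le> w s"
      using s K(1) s1 by (simp add: field_simps)
  qed (use d s1 K(1) in auto)
qed

section \<open>The log-Lipschitz estimate\<close>

text \<open>Majorises the Osgood function by affine functions of \<open>s\<close>, one for each
  \<epsilon>. Affine bounds can be added over coordinates and fed into a Gronwall argument, with
  \<epsilon> chosen last.\<close>

lemma mult_ln_le_affine:
  fixes s \<epsilon> C :: real
  assumes "s > 0" "\<epsilon> > 0" "C > 0"
  shows "s * ln (C / s) \<le> \<epsilon> + ln (C / \<epsilon>) * s"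
proof -
  have "ln (C / s) = ln (C / \<epsilon>) + ln (\<epsilon> / s)" using assms by (simp add: ln_div)
  moreover have "ln (\<epsilon> / s) \<le> \<epsilon> / s" using ln_le_minus_one[of "\<epsilon> / s"] assms by simp
  ultimately have "s * ln (C / s) \<le> s * (ln (C / \<epsilon>) + \<epsilon> / s)" using assms by simp
  then show ?thesis using assms by (simp add: algebra_simps)
qed

text \<open>Near 0 the limit gives \<open>w1 s * exp (w2 s / s) < 1\<close>. Inserting
  \<open>c * s \<le> w1 s\<close> and taking logarithms yields
  \<open>w2 s / s \<le> ln (1 / (c * s))\<close>.\<close>

lemma modulus_log_lipschitz:
  assumes lim: "((\<lambda>s. w1 s * exp (w2 s / s)) \<longlongrightarrow> 0) (at_right (0::real))"
    and c: "c > 0" "s0 > 0" "\<And>s. 0 < s \<Longrightarrow> s \<le> s0 \<Longrightarrow> c * s \<le> w1 s"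
  obtains C \<delta> where "C \<ge> 1" "\<delta> > 0"
    "\<And>s \<epsilon>. 0 < s \<Longrightarrow> s < \<delta> \<Longrightarrow> \<epsilon> > 0 \<Longrightarrow> w2 s \<le> \<epsilon> + ln (C / \<epsilon>) * s"
proof -
  have "\<forall>\<^sub>F s in at_right 0. w1 s * exp (w2 s / s) < 1"
    using order_tendstoD(2)[OF lim, of 1] by simp
  then obtain d where d: "d > 0" "\<And>s. 0 < s \<Longrightarrow> s < d \<Longrightarrow> w1 s * exp (w2 s / s) < 1"
    unfolding eventually_at_right_field by auto
  show thesis
  \<comment> \<open>The maximum with 1 ensures \<open>C \<ge> 1\<close>, which keeps
    \<open>ln (C / \<epsilon>)\<close> nonnegative for \<epsilon> < 1.\<close>
  proof (rule that[of "max 1 (1/c)" "min d s0"])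
    fix s \<epsilon> :: real assume s: "0 < s" "s < min d s0" and \<epsilon>: "\<epsilon> > 0"
    have "c * s * exp (w2 s / s) \<le> w1 s * exp (w2 s / s)" using c(3)[of s] s by simp
    also have "\<dots> < 1" using d s by simp
    finally have "exp (w2 s / s) \<le> (1/c) / s" using c s by (simp add: field_simps)
    also have "\<dots> \<le> max 1 (1/c) / s" using s by (intro divide_right_mono) auto
    finally have "w2 s / s \<le> ln (max 1 (1/c) / s)"
      using s by (subst ln_ge_iff) auto
    then have "w2 s \<le> s * ln (max 1 (1/c) / s)" using s by (simp add: field_simps)
    also have "\<dots> \<le> \<epsilon> + ln (max 1 (1/c) / \<epsilon>) * s" using s \<epsilon> by (intro mult_ln_le_affine) auto
    finally show "w2 s \<le> \<epsilon> + ln (max 1 (1/c) / \<epsilon>) * s" .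
  qed (use d(1) c(2) in auto)
qed

text \<open>The linear lower bound on \<open>w1\<close> turns the limit into an upper bound on
  \<open>w2\<close>, which then controls coordinate steps in the directions
  \<open>T\<close>.\<close>

lemma log_lipschitz_on_box:
  fixes G :: "real^'k::finite \<Rightarrow> 'b::real_normed_vector"
  assumes mono: "mono_on {0..} w1" and "open V" "\<xi>0 \<in> V"
    and mod1: "has_modulus w1 V G" and mod2: "\<And>k. k \<in> T \<Longrightarrow> has_modulus_wrt w2 k V G"
    and lim: "((\<lambda>s. w1 s * exp (w2 s / s)) \<longlongrightarrow> 0) (at_right 0)"
  obtains a b K C where "\<xi>0 \<in> box a b" "cbox a b \<subseteq> V" "K \<ge> 0" "C \<ge> 1"
    "\<And>p q \<epsilon>. p \<in> cbox a b \<Longrightarrow> q \<in> cbox a b \<Longrightarrow> (\<And>k. k \<notin> T \<Longrightarrow> p $ k = q $ k) \<Longrightarrow>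
       0 < \<epsilon> \<Longrightarrow> \<epsilon> < 1 \<Longrightarrow> norm (G p - G q) \<le> K * (\<epsilon> + ln (C / \<epsilon>) * norm (p - q))"
proof -
  obtain a b where ab: "cbox a b \<subseteq> V" "\<xi>0 \<in> box a b"
    by (rule open_contains_cbox[OF assms(2,3)])
  \<comment> \<open>The lower bound on \<open>w1\<close> requires two distinct values of
    \<open>G\<close>; a constant \<open>G\<close> is settled by \<open>K = 0\<close>.\<close>
  show thesis
  proof (cases "\<forall>p\<in>cbox a b. \<forall>q\<in>cbox a b. G p = G q")
    case True
    have const: "norm (G p - G q) \<le> 0 * (\<epsilon> + ln (1 / \<epsilon>) * norm (p - q))" if "p \<in> cbox a b" "q \<in> cbox a b" for p q \<epsilon>
    proof -
      have "G p = G q" using True that by blast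
      then show ?thesis by simp
    qed
    show thesis by (rule that[OF ab(2,1) order_refl order_refl const])
  next
    case False
    then obtain p q where pq: "p \<in> cbox a b" "q \<in> cbox a b" "G p \<noteq> G q" by blast
    have "has_modulus_wrt w1 k (cbox a b) G" for k
      using mod1 ab has_modulus_wrt_subset unfolding has_modulus_def by blast
    then obtain c s0 where c: "c > 0" "s0 > 0" "\<And>s. 0 < s \<Longrightarrow> s \<le> s0 \<Longrightarrow> c * s \<le> w1 s"
      using modulus_ge_linear[OF mono _ pq] by metis
    obtain C \<delta> where C: "C \<ge> 1" "\<delta> > 0"
      "\<And>s \<epsilon>. 0 < s \<Longrightarrow> s < \<delta> \<Longrightarrow> \<epsilon> > 0 \<Longrightarrow> w2 s \<le> \<epsilon> + ln (C / \<epsilon>) * s"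
      using modulus_log_lipschitz[OF lim c] by metis
    obtain \<kappa> where \<kappa>: "\<And>k. k \<in> T \<Longrightarrow> \<kappa> k > 0" "\<And>k \<xi> s. k \<in> T \<Longrightarrow> \<xi> \<in> V \<Longrightarrow> \<xi> + s *\<^sub>R axis k 1 \<in> V \<Longrightarrow>
        norm (G (\<xi> + s *\<^sub>R axis k 1) - G \<xi>) \<le> \<kappa> k * w2 \<bar>s\<bar>"
      using mod2 unfolding has_modulus_wrt_def by metis
    define M where "M = (\<Sum>k\<in>T. \<kappa> k)"
    have M: "M \<ge> 0" "\<And>k. k \<in> T \<Longrightarrow> \<kappa> k \<le> M"
      unfolding M_def using \<kappa>(1) by (auto intro!: sum_nonneg member_le_sum simp: less_imp_le)
    \<comment> \<open>The radius \<open>\<delta>/2\<close> puts any two points of the new box at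
      distance less than \<delta>, so the bound on \<open>w2\<close> applies to every coordinate
      step inside it.\<close>
    obtain a' b' where ab': "cbox a' b' \<subseteq> V \<inter> ball \<xi>0 (\<delta>/2)" "\<xi>0 \<in> box a' b'"
      using open_contains_cbox[of "V \<inter> ball \<xi>0 (\<delta>/2)" \<xi>0] assms(2,3) C(2)
      by (metis IntI centre_in_ball half_gt_zero open_Int open_ball)
    have main: "norm (G p - G q) \<le> real CARD('k) * M * (\<epsilon> + ln (C / \<epsilon>) * norm (p - q))"
      if p: "p \<in> cbox a' b'" and q: "q \<in> cbox a' b'" and pq: "\<And>k. k \<notin> T \<Longrightarrow> p $ k = q $ k"
        and \<epsilon>: "0 < \<epsilon>" "\<epsilon> < 1" for p q \<epsilon>
    proof -
      have lnC: "ln (C / \<epsilon>) \<ge> 0" using C \<epsilon> by simp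
      have "norm (G p - G q) \<le> (\<Sum>k\<in>T. (\<lambda>s. M * (\<epsilon> + ln (C / \<epsilon>) * s)) \<bar>p $ k - q $ k\<bar>)"
      proof (rule norm_diff_le_sum_of_coordinate_steps[OF _ p q pq])
        fix \<xi> k s
        assume k: "k \<in> T" and \<xi>: "\<xi> \<in> cbox a' b'" "\<xi> + s *\<^sub>R axis k 1 \<in> cbox a' b'"
        show "norm (G (\<xi> + s *\<^sub>R axis k 1) - G \<xi>) \<le> M * (\<epsilon> + ln (C / \<epsilon>) * \<bar>s\<bar>)"
        proof (cases "s = 0")
          case True
          then show ?thesis using M \<epsilon> by simp
        next
          case False
          have "dist \<xi> (\<xi> + s *\<^sub>R axis k 1) < \<delta>/2 + \<delta>/2"
            by (rule dist_triangle_less_add[of _ \<xi>0]) (use \<xi> ab' in \<open>auto simp: dist_commute\<close>)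
          then have s: "\<bar>s\<bar> < \<delta>" by (simp add: dist_norm)
          have "norm (G (\<xi> + s *\<^sub>R axis k 1) - G \<xi>) \<le> \<kappa> k * w2 \<bar>s\<bar>"
            using \<kappa>(2)[OF k] \<xi> ab' by blast
          also have "\<dots> \<le> \<kappa> k * (\<epsilon> + ln (C / \<epsilon>) * \<bar>s\<bar>)"
            using C(3)[of "\<bar>s\<bar>" \<epsilon>] s False \<epsilon> \<kappa>(1)[OF k] by (intro mult_left_mono) auto
          also have "\<dots> \<le> M * (\<epsilon> + ln (C / \<epsilon>) * \<bar>s\<bar>)"
            using M k \<epsilon> lnC by (intro mult_right_mono) auto
          finally show ?thesis .
        qed
      qed
      also have "\<dots> \<le> (\<Sum>k\<in>T. M * (\<epsilon> + ln (C / \<epsilon>) * norm (p - q)))"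
        using M lnC component_le_norm_cart[of "p - q"]
        by (intro sum_mono mult_left_mono add_left_mono) auto
      also have "\<dots> \<le> real CARD('k) * (M * (\<epsilon> + ln (C / \<epsilon>) * norm (p - q)))"
        using M lnC \<epsilon> by (auto intro!: mult_right_mono card_mono)
      finally show ?thesis by (simp add: mult.assoc)
    qed
    show thesis
      by (rule that[of a' b' "real CARD('k) * M" C]) (use ab' C M main in auto)
  qed
qed

section \<open>Osgood argument\<close>

text \<open>For fixed \<epsilon>, Gronwall applied to
  \<open>D t \<bullet> D t + \<epsilon>\<^sup>2\<close> multiplies the initial value
  \<open>\<epsilon>\<^sup>2\<close> by a constant times the power \<open>2 * L\<close> of
  \<open>C / \<epsilon>\<close>. As \<open>L \<le> 1/2\<close>, a bound of order \<epsilon>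
  survives, and \<epsilon> tends to 0.\<close>

lemma log_lipschitz_derivative_imp_zero:
  fixes D :: "real \<Rightarrow> 'a::real_inner"
  assumes D: "\<And>t. 0 \<le> t \<Longrightarrow> t \<le> 1 \<Longrightarrow> (D has_vector_derivative D' t) (at t)"
    and D0: "D 0 = 0" and L: "0 \<le> L" "L \<le> 1/2" and C: "C \<ge> 1"
    and bound: "\<And>t \<epsilon>. 0 \<le> t \<Longrightarrow> t \<le> 1 \<Longrightarrow> 0 < \<epsilon> \<Longrightarrow> \<epsilon> < 1 \<Longrightarrow>
        norm (D' t) \<le> L * (\<epsilon> + ln (C / \<epsilon>) * norm (D t))"
  shows "D 1 = 0"
proof -
  have est: "D 1 \<bullet> D 1 \<le> exp (1/2) * C * \<epsilon>" if \<epsilon>: "0 < \<epsilon>" "\<epsilon> < 1" for \<epsilon>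
  proof -
    define k where "k = ln (C / \<epsilon>)"
    \<comment> \<open>The Gronwall rate: the first \<open>L\<close> absorbs the cross term
      \<open>2 * norm (D t) * \<epsilon>\<close>, and \<open>2 * L * k\<close> absorbs the
      logarithmic term.\<close>
    define m where "m = L + 2 * L * k"
    have k: "k \<ge> 0" unfolding k_def using C \<epsilon> by simp
    \<comment> \<open>The squared norm is differentiable also at zeros of \<open>D\<close>, and the
      exponential weight makes \<open>g\<close> nonincreasing.\<close>
    define g where "g t = (D t \<bullet> D t + \<epsilon>\<^sup>2) * exp (- (m * t))" for t
    have "\<exists>y. DERIV g t :> y \<and> y \<le> 0" if t: "0 \<le> t" "t \<le> 1" for t
    proof (intro exI conjI)
      have "((\<lambda>t. D t \<bullet> D t) has_real_derivative 2 * (D t \<bullet> D' t)) (at t)"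
        using bounded_bilinear.has_vector_derivative[OF bounded_bilinear_inner D[OF t] D[OF t]]
        by (simp add: has_real_derivative_iff_has_vector_derivative inner_commute)
      then show "DERIV g t :> (2 * (D t \<bullet> D' t) - m * (D t \<bullet> D t + \<epsilon>\<^sup>2)) * exp (- (m * t))"
        unfolding g_def by (auto intro!: derivative_eq_intros simp: algebra_simps)
      have "D t \<bullet> D' t \<le> norm (D t) * norm (D' t)" by (rule norm_cauchy_schwarz)
      also have "\<dots> \<le> norm (D t) * (L * (\<epsilon> + k * norm (D t)))"
        unfolding k_def using bound[OF t \<epsilon>] by (intro mult_left_mono) auto
      finally have "2 * (D t \<bullet> D' t) \<le> L * (2 * norm (D t) * \<epsilon>) + 2 * L * k * (norm (D t))\<^sup>2"
        by (simp add: algebra_simps power2_eq_square)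
      also have "\<dots> \<le> L * ((norm (D t))\<^sup>2 + \<epsilon>\<^sup>2) + 2 * L * k * ((norm (D t))\<^sup>2 + \<epsilon>\<^sup>2)"
        using L k sum_squares_bound[of "norm (D t)" \<epsilon>]
        by (intro add_mono mult_left_mono) auto
      also have "\<dots> = m * (D t \<bullet> D t + \<epsilon>\<^sup>2)"
        by (simp add: m_def power2_norm_eq_inner algebra_simps)
      finally show "(2 * (D t \<bullet> D' t) - m * (D t \<bullet> D t + \<epsilon>\<^sup>2)) * exp (- (m * t)) \<le> 0"
        by (simp add: mult_nonpos_nonneg)
    qed
    then have "g 1 \<le> g 0" by (rule DERIV_nonpos_imp_nonincreasing[OF zero_le_one])
    then have "(D 1 \<bullet> D 1 + \<epsilon>\<^sup>2) * exp (- m) \<le> \<epsilon>\<^sup>2" by (simp add: g_def D0)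
    then have "D 1 \<bullet> D 1 + \<epsilon>\<^sup>2 \<le> \<epsilon>\<^sup>2 * exp m" by (simp add: exp_minus field_simps)
    \<comment> \<open>Because \<open>2 * L \<le> 1\<close>, the exponential costs at most one of the
      two available powers of \<epsilon>.\<close>
    also have "\<dots> \<le> \<epsilon>\<^sup>2 * exp (1/2 + k)"
      unfolding m_def using L k mult_right_mono[of "2 * L" 1 k] by (intro mult_left_mono) auto
    also have "\<dots> = exp (1/2) * C * \<epsilon>"
      using C \<epsilon> by (simp add: exp_add k_def power2_eq_square)
    finally show ?thesis using zero_le_power2[of \<epsilon>] by linarith
  qed
  have "D 1 \<bullet> D 1 \<le> 0"
  proof (rule tendsto_lowerbound)
    show "((\<lambda>\<epsilon>. exp (1/2) * C * \<epsilon>) \<longlongrightarrow> 0) (at_right (0::real))"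
      by (auto intro!: tendsto_eq_intros)
    show "\<forall>\<^sub>F \<epsilon> in at_right 0. D 1 \<bullet> D 1 \<le> exp (1/2) * C * \<epsilon>"
      unfolding eventually_at_right_field using est by (intro exI[of _ 1]) auto
  qed simp
  then show ?thesis by (simp add: flip: power2_norm_eq_inner)
qed

section \<open>The coefficients as one operator-valued map\<close>

text \<open>The derivative that the PDE prescribes for \<open>y\<close>. As a combination of
  constant operators it inherits continuity and moduli from its coefficients; bounded operators are
  the form in which the inverse function theorem takes derivatives.\<close>

definition slope_map ::
    "('n::finite \<Rightarrow> 'm::finite \<Rightarrow> real^('m + 'n) \<Rightarrow> real) \<Rightarrow> real^('m + 'n) \<Rightarrow> (real^'m) \<Rightarrow>\<^sub>L (real^'n)" where
  "slope_map F \<xi> = (\<Sum>i\<in>UNIV. \<Sum>j\<in>UNIV. F i j \<xi> *\<^sub>R Blinfun (\<lambda>v. v $ j *\<^sub>R axis i 1))"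

lemma blinfun_apply_unit_matrix:
  "blinfun_apply (Blinfun (\<lambda>v::real^'m::finite. v $ j *\<^sub>R axis (i::'n::finite) (1::real))) v = v $ j *\<^sub>R axis i 1"
  by (subst bounded_linear_Blinfun_apply)
     (auto intro: bounded_linear_scaleR_const bounded_linear_vec_nth)

lemma slope_map_apply:
  "blinfun_apply (slope_map F \<xi>) v = (\<chi> i. \<Sum>j\<in>UNIV. F i j \<xi> * v $ j)"
proof -
  have "(\<Sum>j\<in>UNIV. F i j \<xi> * v $ j * axis i 1 $ l) = (if i = l then \<Sum>j\<in>UNIV. F i j \<xi> * v $ j else 0)"
    for i l by (simp add: axis_def)
  then show ?thesis
    by (simp add: slope_map_def blinfun.sum_left blinfun.scaleR_left blinfun_apply_unit_matrix vec_eq_iff)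
qed

lemma continuous_on_slope_map:
  "(\<And>i j. continuous_on V (F i j)) \<Longrightarrow> continuous_on V (slope_map F)"
  unfolding slope_map_def[abs_def] by (intro continuous_intros) auto

lemma has_modulus_wrt_slope_map:
  assumes w: "\<And>s. s \<ge> 0 \<Longrightarrow> w s \<ge> 0" and mod: "\<And>i j. has_modulus_wrt w k V (F i j)"
  shows "has_modulus_wrt w k V (slope_map F)"
proof -
  obtain K where K: "\<And>i j. K i j > 0" "\<And>i j \<xi> s. \<xi> \<in> V \<Longrightarrow> \<xi> + s *\<^sub>R axis k 1 \<in> V \<Longrightarrow>
      norm (F i j (\<xi> + s *\<^sub>R axis k 1) - F i j \<xi>) \<le> K i j * w \<bar>s\<bar>"
    using mod unfolding has_modulus_wrt_def by metis
  let ?E = "\<lambda>i j. Blinfun (\<lambda>v. v $ j *\<^sub>R axis i (1::real))"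
  \<comment> \<open>The summand 1 secures positivity of the constant without evaluating any norm
    \<open>norm (?E i j)\<close>.\<close>
  have "norm (slope_map F (\<xi> + s *\<^sub>R axis k 1) - slope_map F \<xi>)
      \<le> (1 + (\<Sum>i\<in>UNIV. \<Sum>j\<in>UNIV. K i j * norm (?E i j))) * w \<bar>s\<bar>"
    if \<xi>: "\<xi> \<in> V" "\<xi> + s *\<^sub>R axis k 1 \<in> V" for \<xi> s
  proof -
    have "slope_map F (\<xi> + s *\<^sub>R axis k 1) - slope_map F \<xi>
        = (\<Sum>i\<in>UNIV. \<Sum>j\<in>UNIV. (F i j (\<xi> + s *\<^sub>R axis k 1) - F i j \<xi>) *\<^sub>R ?E i j)"
      by (simp add: slope_map_def sum_subtractf scaleR_diff_left)
    also have "norm \<dots> \<le> (\<Sum>i\<in>UNIV. \<Sum>j\<in>UNIV. K i j * w \<bar>s\<bar> * norm (?E i j))"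
      by (intro sum_norm_le, simp only: norm_scaleR)
         (intro mult_right_mono norm_ge_zero K(2)[OF \<xi>, unfolded real_norm_def])
    also have "\<dots> = (\<Sum>i\<in>UNIV. \<Sum>j\<in>UNIV. K i j * norm (?E i j)) * w \<bar>s\<bar>"
      by (simp add: sum_distrib_left mult_ac)
    also have "\<dots> \<le> (1 + (\<Sum>i\<in>UNIV. \<Sum>j\<in>UNIV. K i j * norm (?E i j))) * w \<bar>s\<bar>"
      using w[of "\<bar>s\<bar>"] by (intro mult_right_mono) auto
    finally show ?thesis .
  qed
  moreover have "1 + (\<Sum>i\<in>UNIV. \<Sum>j\<in>UNIV. K i j * norm (?E i j)) > 0"
    using K(1) by (auto intro!: add_pos_nonneg sum_nonneg mult_nonneg_nonneg simp: less_imp_le)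
  ultimately show ?thesis unfolding has_modulus_wrt_def by blast
qed

section \<open>Tangent planes, conormal forms and the minor\<close>

definition x_part :: "real^('m::finite + 'n::finite) \<Rightarrow> real^'m" where
  "x_part w = (\<chi> j. w $ Inl j)"

definition y_part :: "real^('m::finite + 'n::finite) \<Rightarrow> real^'n" where
  "y_part w = (\<chi> i. w $ Inr i)"

text \<open>As \<open>v\<close> varies, these vectors form the plane that the PDE prescribes as
  tangent space of a solution graph through \<xi>.\<close>

definition tangent ::
    "('n::finite \<Rightarrow> 'm::finite \<Rightarrow> real^('m + 'n) \<Rightarrow> real) \<Rightarrow> real^('m + 'n) \<Rightarrow> real^'m \<Rightarrow> real^('m + 'n)" where
  "tangent F \<xi> v = join v (slope_map F \<xi> v)"

text \<open>The values on \<open>w\<close> of the forms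
  \<open>dy\<^sup>i - F\<^sup>i\<^sup>j dx\<^sup>j\<close>, whose common kernel is the tangent plane
  at \<xi>.\<close>

definition conormal ::
    "('n::finite \<Rightarrow> 'm::finite \<Rightarrow> real^('m + 'n) \<Rightarrow> real) \<Rightarrow> real^('m + 'n) \<Rightarrow> real^('m + 'n) \<Rightarrow> real^'n" where
  "conormal F \<xi> w = y_part w - slope_map F \<xi> (x_part w)"

definition coords :: "('m::finite \<Rightarrow> 'k::finite) \<Rightarrow> real^'k \<Rightarrow> real^'m" where
  "coords J w = (\<chi> j. w $ J j)"

lemma x_part_join [simp]: "x_part (join x y) = x" and y_part_join [simp]: "y_part (join x y) = y"
  by (simp_all add: x_part_def y_part_def join_def vec_eq_iff)

lemma bounded_linear_x_part: "bounded_linear x_part"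
  unfolding x_part_def[abs_def] by (intro linear_conv_bounded_linear[THEN iffD1]) (auto intro!: linearI simp: vec_eq_iff)

lemma bounded_linear_y_part: "bounded_linear y_part"
  unfolding y_part_def[abs_def] by (intro linear_conv_bounded_linear[THEN iffD1]) (auto intro!: linearI simp: vec_eq_iff)

lemma bounded_linear_coords: "bounded_linear (coords J)"
  unfolding coords_def[abs_def] by (intro linear_conv_bounded_linear[THEN iffD1]) (auto intro!: linearI simp: vec_eq_iff)

lemma bounded_linear_join: "bounded_linear (\<lambda>p. join (fst p) (snd p))"
  unfolding join_def[abs_def]
  by (intro linear_conv_bounded_linear[THEN iffD1]) (auto intro!: linearI simp: vec_eq_iff split: sum.split)

lemma norm_le_by_components:
  fixes v :: "real^'a::finite" and w :: "real^'b::finite"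
  assumes "inj f" "\<And>j. v $ j = w $ f j"
  shows "norm v \<le> norm w"
proof -
  have "(\<Sum>j\<in>UNIV. (norm (v $ j))\<^sup>2) = (\<Sum>k\<in>range f. (norm (w $ k))\<^sup>2)"
    using assms by (simp add: sum.reindex)
  also have "\<dots> \<le> (\<Sum>k\<in>UNIV. (norm (w $ k))\<^sup>2)" by (intro sum_mono2) auto
  finally show ?thesis unfolding norm_vec_def L2_set_def by (rule real_sqrt_le_mono)
qed

lemma norm_x_part_le: "norm (x_part w) \<le> norm w"
  by (rule norm_le_by_components[of Inl]) (auto simp: x_part_def)

lemma norm_y_part_le: "norm (y_part w) \<le> norm w"
  by (rule norm_le_by_components[of Inr]) (auto simp: y_part_def)

lemma norm_eq_norm_coords:
  assumes "inj J" "\<And>k. k \<notin> range J \<Longrightarrow> w $ k = 0"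
  shows "norm w = norm (coords J w)"
proof -
  have "(\<Sum>j\<in>UNIV. (norm (coords J w $ j))\<^sup>2) = (\<Sum>k\<in>range J. (norm (w $ k))\<^sup>2)"
    using assms(1) by (simp add: sum.reindex coords_def)
  also have "\<dots> = (\<Sum>k\<in>UNIV. (norm (w $ k))\<^sup>2)"
    using assms(2) by (intro sum.mono_neutral_left) auto
  finally show ?thesis unfolding norm_vec_def L2_set_def by simp
qed

lemma bounded_linear_conormal: "bounded_linear (conormal F \<xi>)"
  unfolding conormal_def[abs_def]
  by (intro bounded_linear_sub bounded_linear_y_part
      bounded_linear_compose[OF blinfun.bounded_linear_right bounded_linear_x_part])

lemma conormal_tangent [simp]: "conormal F \<xi> (tangent F \<xi> v) = 0"
  by (simp add: conormal_def tangent_def)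

text \<open>Measures how far a tangent vector at \<eta> leaves the plane at \<xi>. When two lifts
  are compared, this difference of slopes is all that remains.\<close>

lemma conormal_tangent_diff:
  "conormal F \<xi> (tangent F \<eta> v) = (slope_map F \<eta> - slope_map F \<xi>) v"
  by (simp add: conormal_def tangent_def blinfun.diff_left)

lemma norm_conormal_le: "norm (conormal F \<xi> w) \<le> (1 + norm (slope_map F \<xi>)) * norm w"
proof -
  have "norm (conormal F \<xi> w) \<le> norm (y_part w) + norm (slope_map F \<xi> (x_part w))"
    unfolding conormal_def by norm
  also have "\<dots> \<le> norm w + norm (slope_map F \<xi>) * norm w"
    by (intro add_mono norm_y_part_le order_trans[OF norm_blinfun] mult_left_mono norm_x_part_le norm_ge_zero)
  finally show ?thesis by (simp add: algebra_simps)
qed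

text \<open>A repeated index would give the minor two equal columns.\<close>

lemma column_submatrix_inj:
  fixes A :: "real^'k::finite^'n::finite"
  assumes "det (column_submatrix A I) \<noteq> 0"
  shows "inj I"
proof (rule injI, rule ccontr)
  fix a b assume "I a = I b" "a \<noteq> b"
  then have "det (column_submatrix A I) = 0"
    by (intro det_identical_columns[of a b]) (auto simp: column_def column_submatrix_def)
  with assms show False by contradiction
qed

text \<open>The forms \<open>dy\<^sup>i - F\<^sup>i\<^sup>j dx\<^sup>j\<close> have coefficient matrix \<open>hat_matrix\<close> up to the sign of the
  columns belonging to \<open>x\<close>, which does not affect the nonvanishing of the minor.\<close>

lemma conormal_inj_on_columns:
  fixes F :: "'n::finite \<Rightarrow> 'm::finite \<Rightarrow> real^('m + 'n) \<Rightarrow> real"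
  assumes det: "det (column_submatrix (hat_matrix F \<xi>) I) \<noteq> 0"
    and supp: "\<And>k. k \<notin> range I \<Longrightarrow> w $ k = 0" and zero: "conormal F \<xi> w = 0"
  shows "w = 0"
proof -
  have inj: "inj I" by (rule column_submatrix_inj[OF det])
  define w' :: "real^('m + 'n)" where "w' = (\<chi> k. case k of Inl j \<Rightarrow> - w $ k | Inr i \<Rightarrow> w $ k)"
  have w'0: "w' $ k = 0 \<longleftrightarrow> w $ k = 0" for k by (simp add: w'_def split: sum.split)
  have "column_submatrix (hat_matrix F \<xi>) I *v coords I w' = conormal F \<xi> w"
  proof (simp add: vec_eq_iff, intro allI)
    fix i
    have "(column_submatrix (hat_matrix F \<xi>) I *v coords I w') $ i
        = (\<Sum>k\<in>range I. hat_matrix F \<xi> $ i $ k * w' $ k)"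
      using inj by (simp add: matrix_vector_mult_def column_submatrix_def coords_def sum.reindex)
    \<comment> \<open>The vector vanishes off the chosen columns, so the minor acts on it like the
      full matrix.\<close>
    also have "\<dots> = (\<Sum>k\<in>UNIV. hat_matrix F \<xi> $ i $ k * w' $ k)"
      using supp by (intro sum.mono_neutral_left) (auto simp: w'0)
    also have "\<dots> = (\<Sum>j\<in>UNIV. hat_matrix F \<xi> $ i $ Inl j * w' $ Inl j)
        + (\<Sum>l\<in>UNIV. hat_matrix F \<xi> $ i $ Inr l * w' $ Inr l)"
      unfolding UNIV_Plus_UNIV[symmetric] by (subst sum.Plus) auto
    also have "\<dots> = conormal F \<xi> w $ i"
      by (simp add: hat_matrix_def w'_def conormal_def x_part_def y_part_def slope_map_apply
          sum_negf if_distrib[of "\<lambda>x. x * _"] cong: if_cong)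
    finally show "(column_submatrix (hat_matrix F \<xi>) I *v coords I w') $ i = conormal F \<xi> w $ i" .
  qed
  then have "coords I w' = 0"
    using det zero invertible_det_nz invertible_left_inverse matrix_left_invertible_ker by metis
  then have "w' $ I l = 0" for l by (simp add: coords_def vec_eq_iff)
  then show ?thesis using supp w'0 by (metis rangeE vec_eq_iff zero_index)
qed

section \<open>Uniform transversality near the base point\<close>

text \<open>At the base point the forms are injective on the finite-dimensional space of
  \<open>I\<close>-vectors, hence bounded below there by some \<open>e\<close>. By continuity the
  slope moves by less than \<open>e/2\<close> nearby, so \<open>e/2\<close> remains as a uniform
  lower bound.\<close>

lemma transversal_neighbourhood:
  fixes F :: "'n::finite \<Rightarrow> 'm::finite \<Rightarrow> real^('m + 'n) \<Rightarrow> real"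
  assumes "open V" "\<xi>0 \<in> V" and cont: "\<And>i j. continuous_on V (F i j)"
    and det: "det (column_submatrix (hat_matrix F \<xi>0) I) \<noteq> 0"
  obtains W c B where "open W" "\<xi>0 \<in> W" "W \<subseteq> V" "c > 0"
    "\<And>\<xi>. \<xi> \<in> W \<Longrightarrow> norm (slope_map F \<xi>) \<le> B"
    "\<And>\<xi> w. \<xi> \<in> W \<Longrightarrow> (\<And>k. k \<notin> range I \<Longrightarrow> w $ k = 0) \<Longrightarrow> c * norm w \<le> norm (conormal F \<xi> w)"
proof -
  let ?S = "{w::real^('m + 'n). \<forall>k. k \<notin> range I \<longrightarrow> w $ k = 0}"
  have S: "subspace ?S" by (auto simp: subspace_def)
  have "\<exists>e>0. \<forall>w\<in>?S. e * norm w \<le> norm (conormal F \<xi>0 w)"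
    by (rule injective_imp_isometric[OF closed_subspace[OF S] S bounded_linear_conormal])
       (use conormal_inj_on_columns[OF det] in auto)
  then obtain e where e: "e > 0" "\<And>w. w \<in> ?S \<Longrightarrow> e * norm w \<le> norm (conormal F \<xi>0 w)" by blast
  have "isCont (slope_map F) \<xi>0"
    using continuous_on_slope_map[of V F] cont assms(1,2) continuous_on_eq_continuous_at by blast
  then obtain d where d: "d > 0"
      "\<And>\<xi>. dist \<xi> \<xi>0 < d \<Longrightarrow> dist (slope_map F \<xi>) (slope_map F \<xi>0) < e/2"
    using e(1) unfolding continuous_at_eps_delta by (metis half_gt_zero)
  show thesis
  proof (rule that[of "V \<inter> ball \<xi>0 d" "e/2" "norm (slope_map F \<xi>0) + e/2"])
    fix \<xi> assume "\<xi> \<in> V \<inter> ball \<xi>0 d"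
    then have close: "norm (slope_map F \<xi> - slope_map F \<xi>0) < e/2"
      using d(2)[of \<xi>] by (metis IntD2 dist_commute dist_norm mem_ball)
    then show "norm (slope_map F \<xi>) \<le> norm (slope_map F \<xi>0) + e/2"
      using norm_triangle_ineq2[of "slope_map F \<xi>" "slope_map F \<xi>0"] by linarith
    fix w :: "real^('m + 'n)" assume supp: "\<And>k. k \<notin> range I \<Longrightarrow> w $ k = 0"
    have "conormal F \<xi>0 w = conormal F \<xi> w + (slope_map F \<xi> - slope_map F \<xi>0) (x_part w)"
      by (simp add: conormal_def blinfun.diff_left)
    then have "norm (conormal F \<xi>0 w) \<le> norm (conormal F \<xi> w) + norm ((slope_map F \<xi> - slope_map F \<xi>0) (x_part w))"
      by (metis norm_triangle_ineq)
    also have "norm ((slope_map F \<xi> - slope_map F \<xi>0) (x_part w)) \<le> e/2 * norm w"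
      using close e(1) by (intro order_trans[OF norm_blinfun] mult_mono norm_x_part_le) auto
    finally show "e/2 * norm w \<le> norm (conormal F \<xi> w)"
      using e(2)[of w] supp by auto
  qed (use assms d e in auto)
qed

text \<open>Split the tangent vector into its \<open>I\<close>- and \<open>J\<close>-components. The
  forms kill the sum, so they agree up to sign on the two parts, and the lower bound on
  \<open>I\<close>-vectors controls the \<open>I\<close>-part by the \<open>J\<close>-part. Hence
  the \<open>J\<close>-coordinates parametrise the tangent plane.\<close>

lemma norm_tangent_le_norm_coords:
  fixes F :: "'n::finite \<Rightarrow> 'm::finite \<Rightarrow> real^('m + 'n) \<Rightarrow> real"
  assumes J: "inj J" "range J = - range I" and c: "c > 0" and B: "norm (slope_map F \<xi>) \<le> B"
    and below: "\<And>w. (\<And>k. k \<notin> range I \<Longrightarrow> w $ k = 0) \<Longrightarrow> c * norm w \<le> norm (conormal F \<xi> w)"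
  shows "norm (tangent F \<xi> v) \<le> (1 + (1 + B) / c) * norm (coords J (tangent F \<xi> v))"
proof -
  let ?w = "tangent F \<xi> v"
  define wI wJ where "wI = (\<chi> k. if k \<in> range I then ?w $ k else 0)"
    and "wJ = (\<chi> k. if k \<in> range I then 0 else ?w $ k)"
  have w: "?w = wI + wJ" by (simp add: wI_def wJ_def vec_eq_iff)
  have wJ: "norm wJ = norm (coords J ?w)"
  proof -
    have "J j \<notin> range I" for j using J by blast
    then have "coords J wJ = coords J ?w" by (simp add: coords_def wJ_def)
    moreover have "norm wJ = norm (coords J wJ)"
      by (rule norm_eq_norm_coords[OF J(1)]) (use J(2) in \<open>auto simp: wJ_def\<close>)
    ultimately show ?thesis by simp
  qed
  interpret C: bounded_linear "conormal F \<xi>" by (rule bounded_linear_conormal)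
  have "conormal F \<xi> wI = - conormal F \<xi> wJ"
    using conormal_tangent[of F \<xi> v] unfolding w C.add by (simp add: eq_neg_iff_add_eq_0)
  then have "c * norm wI \<le> norm (conormal F \<xi> wJ)"
    using below[of wI] by (simp add: wI_def)
  also have "\<dots> \<le> (1 + B) * norm wJ"
    using B by (intro order_trans[OF norm_conormal_le] mult_right_mono) auto
  finally have "norm wI \<le> (1 + B) / c * norm wJ" using c by (simp add: field_simps)
  moreover have "norm ?w \<le> norm wI + norm wJ" unfolding w by (rule norm_triangle_ineq)
  ultimately show ?thesis unfolding wJ[symmetric] by (simp add: algebra_simps)
qed

section \<open>Solution graphs over the complementary coordinates\<close>

text \<open>Differentiability supplies a total derivative; the chain rule along coordinate lines
  identifies its matrix entries with the prescribed partial derivatives.\<close>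

lemma local_solution_derivative:
  assumes "local_solution F V x0 y0 y"
  obtains A where "open A" "x0 \<in> A" "continuous_on A y" "\<And>x. x \<in> A \<Longrightarrow> join x (y x) \<in> V"
    "\<And>x. x \<in> A \<Longrightarrow> (y has_derivative slope_map F (join x (y x))) (at x)"
proof -
  obtain A where A: "open A" "x0 \<in> A" "y differentiable_on A"
    and V: "\<And>x. x \<in> A \<Longrightarrow> join x (y x) \<in> V"
    and part: "\<And>x i j. x \<in> A \<Longrightarrow>
      ((\<lambda>t. y (x + t *\<^sub>R axis j 1) $ i) has_real_derivative F i j (join x (y x))) (at 0)"
    using assms unfolding local_solution_def by blast
  have "(y has_derivative slope_map F (join x (y x))) (at x)" if x: "x \<in> A" for x
  proof -
    obtain D where D: "(y has_derivative D) (at x)"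
      using A(3) x at_within_open[OF x A(1)] unfolding differentiable_on_def differentiable_def by auto
    have comp: "D (axis j 1) $ i = F i j (join x (y x))" for i j
    proof -
      have "((\<lambda>t. x + t *\<^sub>R axis j 1) has_derivative (\<lambda>t. t *\<^sub>R axis j 1)) (at (0::real))"
        by (auto intro!: derivative_eq_intros)
      then have "((\<lambda>t. y (x + t *\<^sub>R axis j 1)) has_derivative (\<lambda>t. D (t *\<^sub>R axis j 1))) (at 0)"
        by (rule has_derivative_compose) (simp add: D)
      then have "((\<lambda>t. y (x + t *\<^sub>R axis j 1) $ i) has_derivative (\<lambda>t. D (t *\<^sub>R axis j 1) $ i)) (at 0)"
        by (rule bounded_linear.has_derivative[OF bounded_linear_vec_nth])
      moreover have "D (t *\<^sub>R axis j 1) $ i = D (axis j 1) $ i * t" for t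
        using linear_cmul[OF has_derivative_linear[OF D]] by simp
      ultimately have "((\<lambda>t. y (x + t *\<^sub>R axis j 1) $ i) has_real_derivative D (axis j 1) $ i) (at 0)"
        unfolding has_field_derivative_def by simp
      then show ?thesis using part[OF x] DERIV_unique by blast
    qed
    have "D v = slope_map F (join x (y x)) v" for v
    proof -
      have "D v = D (\<Sum>j\<in>UNIV. v $ j *\<^sub>R axis j 1)"
        using basis_expansion[of v] by (simp add: scalar_mult_eq_scaleR)
      also have "\<dots> = (\<Sum>j\<in>UNIV. v $ j *\<^sub>R D (axis j 1))"
        using has_derivative_linear[OF D] by (simp add: linear_sum linear_cmul)
      finally show ?thesis by (simp add: vec_eq_iff comp slope_map_apply mult.commute)
    qed
    then have "D = slope_map F (join x (y x))" by (rule ext)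
    with D show ?thesis by simp
  qed
  then show thesis
    using that A V by (metis differentiable_imp_continuous_on)
qed

text \<open>A solution graph reparametrised by its \<open>J\<close>-coordinates. The vector
  \<open>\<nu> u e\<close> is the x-velocity of the lift when \<open>u\<close> moves with velocity
  \<open>e\<close>; \<open>S\<close> is where the estimates are available.\<close>

definition is_lift ::
    "('n::finite \<Rightarrow> 'm::finite \<Rightarrow> real^('m + 'n) \<Rightarrow> real) \<Rightarrow> ('m \<Rightarrow> 'm + 'n) \<Rightarrow> (real^('m + 'n)) set \<Rightarrow>
     (real^'m) set \<Rightarrow> (real^'m \<Rightarrow> real^('m + 'n)) \<Rightarrow> (real^'m \<Rightarrow> real^'m \<Rightarrow> real^'m) \<Rightarrow> bool" where
  "is_lift F J S U \<gamma> \<nu> \<longleftrightarrow> (\<forall>u\<in>U. \<gamma> u \<in> S \<and> coords J (\<gamma> u) = u \<and>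
     (\<gamma> has_derivative (\<lambda>e. tangent F (\<gamma> u) (\<nu> u e))) (at u) \<and>
     (\<forall>e. coords J (tangent F (\<gamma> u) (\<nu> u e)) = e))"

text \<open>The inverse function theorem for the map sending \<open>x\<close> to the
  \<open>J\<close>-coordinates of its graph point. The last clause covers all smaller radii because
  the comparison of two lifts later shrinks the ball.\<close>

lemma local_solution_chart:
  fixes F :: "'n::finite \<Rightarrow> 'm::finite \<Rightarrow> real^('m + 'n) \<Rightarrow> real" and J :: "'m \<Rightarrow> 'm + 'n"
  assumes sol: "local_solution F V x0 y0 y"
    and cont: "\<And>i j. continuous_on V (F i j)"
    and W: "open W" "join x0 y0 \<in> W"
    and lower: "\<And>\<xi> v. \<xi> \<in> W \<Longrightarrow> norm (tangent F \<xi> v) \<le> Q * norm (coords J (tangent F \<xi> v))"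
  obtains r \<gamma> \<nu> where "r > 0" "\<gamma> (coords J (join x0 y0)) = join x0 y0"
    "is_lift F J W (ball (coords J (join x0 y0)) r) \<gamma> \<nu>"
    "\<forall>u\<in>ball (coords J (join x0 y0)) r. y_part (\<gamma> u) = y (x_part (\<gamma> u))"
    "\<forall>r'. 0 < r' \<and> r' \<le> r \<longrightarrow> (\<forall>\<^sub>F x in nhds x0.
       coords J (join x (y x)) \<in> ball (coords J (join x0 y0)) r' \<and>
       \<gamma> (coords J (join x (y x))) = join x (y x))"
proof -
  obtain A where A: "open A" "x0 \<in> A" "continuous_on A y" "\<And>x. x \<in> A \<Longrightarrow> join x (y x) \<in> V"
    and der: "\<And>x. x \<in> A \<Longrightarrow> (y has_derivative slope_map F (join x (y x))) (at x)"
    using local_solution_derivative[OF sol] by metis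
  have y0: "y x0 = y0" using sol by (simp add: local_solution_def)
  let ?G = "\<lambda>x. join x (y x)"
  have contG: "continuous_on A ?G"
    using bounded_linear.continuous_on[OF bounded_linear_join, of A "\<lambda>x. (x, y x)"] A(3)
    by (simp add: continuous_on_Pair continuous_on_id)
  have derG: "(?G has_derivative tangent F (?G x)) (at x)" if "x \<in> A" for x
    using bounded_linear.has_derivative[OF bounded_linear_join has_derivative_Pair[OF has_derivative_ident der[OF that]]]
    by (simp add: tangent_def[abs_def])
  define U where "U = A \<inter> ?G -` W"
  have U: "open U" "x0 \<in> U" "U \<subseteq> A"
    using continuous_open_preimage[OF contG A(1) W(1)] A(2) W(2) y0 by (auto simp: U_def)
  define P :: "(real^('m + 'n)) \<Rightarrow>\<^sub>L (real^'m)" where "P = Blinfun (coords J)"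
  define j1 :: "(real^'m) \<Rightarrow>\<^sub>L (real^('m + 'n))" where "j1 = Blinfun (\<lambda>v. join v 0)"
  define j2 :: "(real^'n) \<Rightarrow>\<^sub>L (real^('m + 'n))" where "j2 = Blinfun (\<lambda>v. join 0 v)"
  have P: "blinfun_apply P w = coords J w" for w
    unfolding P_def by (simp add: bounded_linear_Blinfun_apply bounded_linear_coords)
  have j1: "blinfun_apply j1 v = join v 0" for v
    unfolding j1_def using bounded_linear_compose[OF bounded_linear_join, of "\<lambda>v::real^'m. (v, 0::real^'n)"]
    by (simp add: bounded_linear_Blinfun_apply bounded_linear_Pair bounded_linear_ident bounded_linear_zero)
  have j2: "blinfun_apply j2 v = join 0 v" for v
    unfolding j2_def using bounded_linear_compose[OF bounded_linear_join, of "\<lambda>v::real^'n. (0::real^'m, v)"]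
    by (simp add: bounded_linear_Blinfun_apply bounded_linear_Pair bounded_linear_ident bounded_linear_zero)
  define \<Phi> where "\<Phi> x = coords J (?G x)" for x
  \<comment> \<open>The derivative of \<Phi>, composed from operators so that its continuity follows
    from that of \<open>slope_map\<close>.\<close>
  define \<Phi>' where "\<Phi>' x = P o\<^sub>L (j1 + (j2 o\<^sub>L slope_map F (?G x)))" for x
  have \<Phi>': "blinfun_apply (\<Phi>' x) v = coords J (tangent F (?G x) v)" for x v
  proof -
    have "join v 0 + join 0 w = join v w" for w :: "real^'n"
      by (simp add: join_def vec_eq_iff split: sum.split)
    then show ?thesis
      by (simp add: \<Phi>'_def tangent_def P j1 j2 blinfun.add_left)
  qed
  have der\<Phi>: "(\<Phi> has_derivative blinfun_apply (\<Phi>' x)) (at x)" if "x \<in> U" for x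
    using bounded_linear.has_derivative[OF bounded_linear_coords derG, of x J] that U(3)
    unfolding \<Phi>_def[abs_def] \<Phi>'[abs_def] by auto
  have cont\<Phi>': "continuous_on U \<Phi>'"
  proof -
    have "continuous_on A (\<lambda>x. slope_map F (?G x))"
      by (rule continuous_on_compose2[OF continuous_on_slope_map contG]) (use cont A(4) in auto)
    then have "continuous_on U (\<lambda>x. slope_map F (?G x))" using U(3) continuous_on_subset by blast
    then show ?thesis unfolding \<Phi>'_def[abs_def]
      by (intro continuous_intros bounded_bilinear.continuous_on[OF bounded_bilinear_blinfun_compose])
  qed
  \<comment> \<open>Vanishing \<open>J\<close>-coordinates force the tangent vector to vanish by
    \<open>lower\<close>, and \<open>v\<close> is its x-part. The resulting left inverse is what the
    inverse function theorem asks for.\<close>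
  have inj: "inj (blinfun_apply (\<Phi>' x0))"
    unfolding linear_injective_0[OF bounded_linear.linear[OF blinfun.bounded_linear_right]]
  proof (intro allI impI)
    fix v assume "blinfun_apply (\<Phi>' x0) v = 0"
    then have "tangent F (join x0 y0) v = 0" using lower[OF W(2), of v] by (simp add: \<Phi>' y0)
    then show "v = 0" by (metis tangent_def x_part_join bounded_linear_x_part linear_0 bounded_linear.linear)
  qed
  obtain h where h: "linear h" "h \<circ> blinfun_apply (\<Phi>' x0) = id"
    using linear_injective_left_inverse[OF bounded_linear.linear[OF blinfun.bounded_linear_right] inj] by blast
  have inv: "Blinfun h o\<^sub>L \<Phi>' x0 = id_blinfun"
  proof (rule blinfun_eqI)
    fix v
    show "blinfun_apply (Blinfun h o\<^sub>L \<Phi>' x0) v = blinfun_apply id_blinfun v"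
      using h(2) by (simp add: bounded_linear_Blinfun_apply[OF linear_conv_bounded_linear[THEN iffD1, OF h(1)]] fun_eq_iff)
  qed
  obtain U' V' g g' where U': "open U'" "U' \<subseteq> U" "x0 \<in> U'" and V': "open V'" "\<Phi> x0 \<in> V'"
    and hom: "homeomorphism U' V' \<Phi> g"
    and derg: "\<And>u. u \<in> V' \<Longrightarrow> (g has_derivative (g' u)) (at u)"
    and g': "\<And>u. u \<in> V' \<Longrightarrow> g' u = inv (blinfun_apply (\<Phi>' (g u)))"
    and bij: "\<And>u. u \<in> V' \<Longrightarrow> bij (blinfun_apply (\<Phi>' (g u)))"
    using inverse_function_theorem[OF U(1) der\<Phi> cont\<Phi>' U(2) inv] by metis
  obtain r where r: "r > 0" "ball (\<Phi> x0) r \<subseteq> V'" using V' open_contains_ball by metis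
  have gU: "g u \<in> U" if "u \<in> V'" for u using hom that U'(2) by (auto simp: homeomorphism_def)
  have \<Phi>0: "\<Phi> x0 = coords J (join x0 y0)" by (simp add: \<Phi>_def y0)
  have gx0: "g (\<Phi> x0) = x0" using hom U'(3) by (simp add: homeomorphism_def)
  \<comment> \<open>The lift is the graph map after the local inverse \<open>g\<close>, with the
    derivative of \<open>g\<close> as its x-velocity.\<close>
  show thesis
  proof (rule that[of r "\<lambda>u. ?G (g u)" g'])
    show "?G (g (coords J (join x0 y0))) = join x0 y0" by (simp add: \<Phi>0[symmetric] gx0 y0)
    show "is_lift F J W (ball (coords J (join x0 y0)) r) (\<lambda>u. ?G (g u)) g'"
      unfolding is_lift_def
    proof (intro ballI conjI allI)
      fix u assume "u \<in> ball (coords J (join x0 y0)) r"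
      then have u: "u \<in> V'" using r(2) by (auto simp: \<Phi>0)
      show "?G (g u) \<in> W" "coords J (?G (g u)) = u"
        using gU[OF u] hom u by (auto simp: U_def homeomorphism_def \<Phi>_def)
      show "((\<lambda>u. ?G (g u)) has_derivative (\<lambda>e. tangent F (?G (g u)) (g' u e))) (at u)"
        by (rule has_derivative_compose[OF derg[OF u] derG]) (use gU[OF u] U(3) in auto)
      show "coords J (tangent F (?G (g u)) (g' u e)) = e" for e
        unfolding \<Phi>'[symmetric] g'[OF u] by (rule surj_f_inv_f[OF bij_is_surj[OF bij[OF u]]])
    qed
    show "\<forall>u\<in>ball (coords J (join x0 y0)) r. y_part (?G (g u)) = y (x_part (?G (g u)))" by simp
    show "\<forall>r'. 0 < r' \<and> r' \<le> r \<longrightarrow> (\<forall>\<^sub>F x in nhds x0. coords J (?G x) \<in> ball (coords J (join x0 y0)) r' \<and>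
       ?G (g (coords J (?G x))) = ?G x)"
    proof (intro allI impI)
      fix r' :: real assume r': "0 < r' \<and> r' \<le> r"
      have "open (U' \<inter> \<Phi> -` ball (\<Phi> x0) r')"
        using homeomorphism_cont1[OF hom] U'(1) by (intro continuous_open_preimage) auto
      moreover have "x0 \<in> U' \<inter> \<Phi> -` ball (\<Phi> x0) r'" using U'(3) r' by simp
      moreover have "\<Phi> x \<in> ball (\<Phi> x0) r' \<and> ?G (g (\<Phi> x)) = ?G x" if "x \<in> U' \<inter> \<Phi> -` ball (\<Phi> x0) r'" for x
        using hom that by (auto simp: homeomorphism_def)
      ultimately show "\<forall>\<^sub>F x in nhds x0. coords J (?G x) \<in> ball (coords J (join x0 y0)) r' \<and>
         ?G (g (coords J (?G x))) = ?G x"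
        unfolding eventually_nhds \<Phi>0[symmetric] \<Phi>_def[symmetric] by blast
    qed
  qed (rule r(1))
qed

section \<open>Comparison of two lifts\<close>

text \<open>Apply the Osgood argument to the difference of the lifts along the segment from
  \<open>u0\<close> to \<open>u\<close>. Applying the forms at a point of the first lift removes its
  own velocity and leaves a slope difference acting on the velocity of the second.\<close>

lemma lifts_agree:
  fixes F :: "'n::finite \<Rightarrow> 'm::finite \<Rightarrow> real^('m + 'n) \<Rightarrow> real" and J :: "'m \<Rightarrow> 'm + 'n"
    and \<gamma>1 \<gamma>2 :: "real^'m \<Rightarrow> real^('m + 'n)"
  assumes J: "inj J" "range J = - range I" and c: "c > 0" and Q: "Q \<ge> 0" and K: "K \<ge> 0" and C: "C \<ge> 1"
    and below: "\<And>\<xi> w. \<xi> \<in> S \<Longrightarrow> (\<And>k. k \<notin> range I \<Longrightarrow> w $ k = 0) \<Longrightarrow> c * norm w \<le> norm (conormal F \<xi> w)"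
    and lower: "\<And>\<xi> v. \<xi> \<in> S \<Longrightarrow> norm (tangent F \<xi> v) \<le> Q * norm (coords J (tangent F \<xi> v))"
    and loglip: "\<And>p q \<epsilon>. p \<in> S \<Longrightarrow> q \<in> S \<Longrightarrow> (\<And>k. k \<notin> range I \<Longrightarrow> p $ k = q $ k) \<Longrightarrow>
       0 < \<epsilon> \<Longrightarrow> \<epsilon> < 1 \<Longrightarrow> norm (slope_map F p - slope_map F q) \<le> K * (\<epsilon> + ln (C / \<epsilon>) * norm (p - q))"
    and lift1: "is_lift F J S (ball u0 r) \<gamma>1 \<nu>1" and lift2: "is_lift F J S (ball u0 r) \<gamma>2 \<nu>2"
    and init: "\<gamma>1 u0 = \<gamma>2 u0" and r: "2 * K * Q * r \<le> c" and u: "u \<in> ball u0 r"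
  shows "\<gamma>1 u = \<gamma>2 u"
proof -
  note \<gamma>1 = lift1[unfolded is_lift_def, rule_format] and \<gamma>2 = lift2[unfolded is_lift_def, rule_format]
  define e where "e = u - u0"
  define p where "p t = u0 + t *\<^sub>R e" for t :: real
  define D where "D t = \<gamma>1 (p t) - \<gamma>2 (p t)" for t
  define D' where "D' t = tangent F (\<gamma>1 (p t)) (\<nu>1 (p t) e) - tangent F (\<gamma>2 (p t)) (\<nu>2 (p t) e)" for t
  have e: "norm e < r" using u by (simp add: e_def dist_norm norm_minus_commute)
  have p_in: "p t \<in> ball u0 r" if "0 \<le> t" "t \<le> 1" for t
    using that e mult_right_mono[of t 1 "norm e"] by (simp add: p_def dist_norm)
  have der_p: "(p has_vector_derivative e) (at t)" for t
    unfolding p_def[abs_def] by (auto intro!: derivative_eq_intros)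
  \<comment> \<open>\<open>J\<close> exhausts the complement of \<open>I\<close>, so equal
    \<open>J\<close>-coordinates leave only \<open>I\<close>-directions; this serves for both
    positions and velocities.\<close>
  have off_I: "w $ k = w' $ k" if eq: "coords J w = coords J w'" and k: "k \<notin> range I" for w w' :: "real^('m + 'n)" and k
    proof -
    obtain j where "k = J j" using k J(2) by blast
    then show ?thesis using eq by (simp add: coords_def vec_eq_iff)
  qed
  have "D 1 = 0"
  \<comment> \<open>In this rate \<open>K\<close> is the log-Lipschitz constant of the slope,
    \<open>Q * norm e\<close> bounds the x-velocity of the second lift, and \<open>1 / c\<close>
    comes from inverting the forms on \<open>I\<close>-vectors.\<close>
  proof (rule log_lipschitz_derivative_imp_zero[of D D' "K * Q * norm e / c" C])
    fix t :: real assume t: "0 \<le> t" "t \<le> 1"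
    note pt = p_in[OF t]
    have "((\<gamma>1 \<circ> p) has_vector_derivative tangent F (\<gamma>1 (p t)) (\<nu>1 (p t) e)) (at t)"
      by (rule vector_derivative_diff_chain_within[of p e t UNIV])
         (use der_p in \<open>simp\<close>, use \<gamma>1[OF pt] has_derivative_at_withinI in blast)
    moreover have "((\<gamma>2 \<circ> p) has_vector_derivative tangent F (\<gamma>2 (p t)) (\<nu>2 (p t) e)) (at t)"
      by (rule vector_derivative_diff_chain_within[of p e t UNIV])
         (use der_p in \<open>simp\<close>, use \<gamma>2[OF pt] has_derivative_at_withinI in blast)
    ultimately show "(D has_vector_derivative D' t) (at t)"
      unfolding D_def[abs_def] D'_def comp_def by (rule has_vector_derivative_diff)
    fix \<epsilon> :: real assume \<epsilon>: "0 < \<epsilon>" "\<epsilon> < 1"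
    let ?\<xi> = "\<gamma>1 (p t)" and ?\<eta> = "\<gamma>2 (p t)" and ?v = "\<nu>2 (p t) e"
    have S: "?\<xi> \<in> S" "?\<eta> \<in> S" using \<gamma>1[OF pt] \<gamma>2[OF pt] by auto
    have ll: "norm (slope_map F ?\<eta> - slope_map F ?\<xi>) \<le> K * (\<epsilon> + ln (C / \<epsilon>) * norm (D t))"
      using loglip[OF S(2,1) off_I \<epsilon>] \<gamma>1[OF pt] \<gamma>2[OF pt]
      by (simp add: D_def norm_minus_commute)
    have lnC: "ln (C / \<epsilon>) \<ge> 0" using C \<epsilon> by simp
    \<comment> \<open>\<open>?v\<close> is the x-part of a tangent vector whose
      \<open>J\<close>-coordinates are \<open>e\<close>.\<close>
    have "norm ?v \<le> norm (tangent F ?\<eta> ?v)"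
      using norm_x_part_le[of "tangent F ?\<eta> ?v"] by (simp add: tangent_def)
    also have "\<dots> \<le> Q * norm e" using lower[OF S(2), of ?v] by (simp add: \<gamma>2[OF pt])
    finally have v: "norm ?v \<le> Q * norm e" .
    interpret B: bounded_linear "conormal F ?\<xi>" by (rule bounded_linear_conormal)
    have "c * norm (D' t) \<le> norm (conormal F ?\<xi> (D' t))"
    proof (rule below[OF S(1)])
      fix k assume "k \<notin> range I"
      then show "D' t $ k = 0"
        using off_I[of "tangent F ?\<xi> (\<nu>1 (p t) e)" "tangent F ?\<eta> ?v" k] \<gamma>1[OF pt] \<gamma>2[OF pt]
        by (simp add: D'_def)
    qed
    also have "\<dots> = norm ((slope_map F ?\<eta> - slope_map F ?\<xi>) ?v)"
      by (simp add: D'_def B.diff conormal_tangent_diff)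
    also have "\<dots> \<le> norm (slope_map F ?\<eta> - slope_map F ?\<xi>) * norm ?v" by (rule norm_blinfun)
    also have "\<dots> \<le> (K * (\<epsilon> + ln (C / \<epsilon>) * norm (D t))) * (Q * norm e)"
      using K lnC \<epsilon> by (intro mult_mono ll v) auto
    finally show "norm (D' t) \<le> K * Q * norm e / c * (\<epsilon> + ln (C / \<epsilon>) * norm (D t))"
      using c by (simp add: field_simps)
  next
    \<comment> \<open>The radius was bounded precisely so that the Osgood rate stays at most
      1/2.\<close>
    have "2 * (K * Q) * norm e \<le> 2 * (K * Q) * r" using e K Q by (intro mult_left_mono) auto
    then show "K * Q * norm e / c \<le> 1/2" using r c by (simp add: field_simps)
  qed (use init C K Q c in \<open>auto simp: D_def p_def\<close>)
  then show ?thesis by (simp add: D_def p_def e_def)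
qed

section \<open>Uniqueness of the solution\<close>

theorem theorem2:
  fixes V :: "(real^('m::finite + 'n::finite)) set"
    and F :: "'n \<Rightarrow> 'm \<Rightarrow> real^('m + 'n) \<Rightarrow> real"
    and w1 w2 :: "real \<Rightarrow> real"
    and x0 :: "real^'m" and y0 :: "real^'n"
    and I :: "'n \<Rightarrow> 'm + 'n"
  assumes "modulus_function w1" and "modulus_function w2"
    and "open V"
    and "\<And>i j. continuous_on V (F i j)"
    and "\<And>i j. has_modulus w1 V (F i j)"
    and "join x0 y0 \<in> V"
    and "det (column_submatrix (hat_matrix F (join x0 y0)) I) \<noteq> 0"
    and "\<And>i j l. has_modulus_wrt w2 (I l) V (F i j)"
    and "((\<lambda>s. w1 s * exp (w2 s / s)) \<longlongrightarrow> 0) (at_right 0)"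
    and "\<exists>y. local_solution F V x0 y0 y"
  shows "\<forall>y z. local_solution F V x0 y0 y \<longrightarrow> local_solution F V x0 y0 z \<longrightarrow>
           (\<forall>\<^sub>F x in nhds x0. y x = z x)"
proof (intro allI impI)
  fix y z assume y: "local_solution F V x0 y0 y" and z: "local_solution F V x0 y0 z"
  let ?\<xi> = "join x0 y0"
  obtain W c B where W: "open W" "?\<xi> \<in> W" "W \<subseteq> V" and c: "c > 0"
    and B: "\<And>\<xi>. \<xi> \<in> W \<Longrightarrow> norm (slope_map F \<xi>) \<le> B"
    and below: "\<And>\<xi> w. \<xi> \<in> W \<Longrightarrow> (\<And>k. k \<notin> range I \<Longrightarrow> w $ k = 0) \<Longrightarrow> c * norm w \<le> norm (conormal F \<xi> w)"
    using transversal_neighbourhood[OF assms(3,6,4,7)] by metis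
  have w: "\<And>s. s \<ge> 0 \<Longrightarrow> w1 s \<ge> 0" "\<And>s. s \<ge> 0 \<Longrightarrow> w2 s \<ge> 0" "mono_on {0..} w1"
    using assms(1,2) by (auto simp: modulus_function_def)
  have mod1: "has_modulus w1 W (slope_map F)"
    unfolding has_modulus_def
  proof
    fix k
    have "has_modulus_wrt w1 k V (slope_map F)"
      by (rule has_modulus_wrt_slope_map[OF w(1)]) (use assms(5) in \<open>auto simp: has_modulus_def\<close>)
    then show "has_modulus_wrt w1 k W (slope_map F)" using W(3) by (rule has_modulus_wrt_subset)
  qed
  have mod2: "has_modulus_wrt w2 k W (slope_map F)" if "k \<in> range I" for k
  proof -
    have "has_modulus_wrt w2 k V (slope_map F)"
      by (rule has_modulus_wrt_slope_map[OF w(2)]) (use assms(8) that in auto)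
    then show ?thesis using W(3) by (rule has_modulus_wrt_subset)
  qed
  obtain a b K C where ab: "?\<xi> \<in> box a b" "cbox a b \<subseteq> W" and K: "K \<ge> 0" and C: "C \<ge> 1"
    and loglip: "\<And>p q \<epsilon>. p \<in> cbox a b \<Longrightarrow> q \<in> cbox a b \<Longrightarrow> (\<And>k. k \<notin> range I \<Longrightarrow> p $ k = q $ k) \<Longrightarrow>
       0 < \<epsilon> \<Longrightarrow> \<epsilon> < 1 \<Longrightarrow> norm (slope_map F p - slope_map F q) \<le> K * (\<epsilon> + ln (C / \<epsilon>) * norm (p - q))"
    using log_lipschitz_on_box[OF w(3) W(1,2) mod1 mod2 assms(9)] by metis
  \<comment> \<open>The chart lemma wants an open set, while the log-Lipschitz estimate lives on the
    closed box; the open box serves both.\<close>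
  have box: "box a b \<subseteq> W" "box a b \<subseteq> cbox a b" using ab box_subset_cbox by blast+
  \<comment> \<open>Injectivity of \<open>I\<close> leaves exactly as many complementary coordinates
    as there are x-variables, so they can be indexed by \<open>'m\<close>.\<close>
  have "card (range I) = CARD('n)"
    by (rule card_image[OF column_submatrix_inj[OF assms(7)]])
  then have "card (- range I) = CARD('m)"
    by (simp add: Compl_eq_Diff_UNIV card_Diff_subset card_UNIV_sum)
  then obtain J :: "'m \<Rightarrow> 'm + 'n" where "bij_betw J UNIV (- range I)"
    by (metis finite finite_same_card_bij)
  then have J: "inj J" "range J = - range I" by (auto simp: bij_betw_def)
  let ?base = "coords J ?\<xi>"
  define Q where "Q = 1 + (1 + B) / c"
  have "B \<ge> 0" using B[OF W(2)] norm_ge_zero order_trans by blast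
  then have Q: "Q \<ge> 0" using c by (simp add: Q_def)
  have lower: "norm (tangent F \<xi> v) \<le> Q * norm (coords J (tangent F \<xi> v))" if "\<xi> \<in> box a b" for \<xi> v
    unfolding Q_def using that box(1) by (intro norm_tangent_le_norm_coords[OF J c] B below) auto
  obtain r1 \<gamma>1 \<nu>1 where r1: "r1 > 0" "\<gamma>1 ?base = ?\<xi>"
    and lift1: "is_lift F J (box a b) (ball ?base r1) \<gamma>1 \<nu>1"
    and graph1: "\<forall>u\<in>ball ?base r1. y_part (\<gamma>1 u) = y (x_part (\<gamma>1 u))"
    and ev1: "\<forall>r'. 0 < r' \<and> r' \<le> r1 \<longrightarrow> (\<forall>\<^sub>F x in nhds x0. coords J (join x (y x)) \<in> ball ?base r' \<and>
       \<gamma>1 (coords J (join x (y x))) = join x (y x))"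
    by (rule local_solution_chart[OF y assms(4) open_box ab(1) lower])
  obtain r2 \<gamma>2 \<nu>2 where r2: "r2 > 0" "\<gamma>2 ?base = ?\<xi>"
    and lift2: "is_lift F J (box a b) (ball ?base r2) \<gamma>2 \<nu>2"
    and graph2: "\<forall>u\<in>ball ?base r2. y_part (\<gamma>2 u) = z (x_part (\<gamma>2 u))"
    and ev2: "\<forall>r'. 0 < r' \<and> r' \<le> r2 \<longrightarrow> (\<forall>\<^sub>F x in nhds x0. coords J (join x (z x)) \<in> ball ?base r' \<and>
       \<gamma>2 (coords J (join x (z x))) = join x (z x))"
    by (rule local_solution_chart[OF z assms(4) open_box ab(1) lower])
  \<comment> \<open>The second bound gives the smallness required of the radius; the
    \<open>+ 1\<close> covers \<open>K * Q = 0\<close>.\<close>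
  define r where "r = min (min r1 r2) (c / (2 * (K * Q + 1)))"
  have KQ: "K * Q \<ge> 0" using K Q by simp
  have r: "r > 0" "r \<le> r1" "r \<le> r2" using r1(1) r2(1) c KQ by (auto simp: r_def)
  have "2 * (K * Q) * r \<le> 2 * (K * Q) * (c / (2 * (K * Q + 1)))"
    using KQ by (intro mult_left_mono) (auto simp: r_def)
  also have "\<dots> \<le> c" using KQ c by (simp add: field_simps)
  finally have small: "2 * K * Q * r \<le> c" by (simp add: mult.assoc)
  have ball: "ball ?base r \<subseteq> ball ?base r1" "ball ?base r \<subseteq> ball ?base r2"
    using r by (auto intro: subset_ball)
  have lifts: "is_lift F J (box a b) (ball ?base r) \<gamma>1 \<nu>1" "is_lift F J (box a b) (ball ?base r) \<gamma>2 \<nu>2"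
    using lift1 lift2 ball unfolding is_lift_def by blast+
  have below': "c * norm w \<le> norm (conormal F \<xi> w)"
    if "\<xi> \<in> box a b" "\<And>k. k \<notin> range I \<Longrightarrow> w $ k = 0" for \<xi> w
    using below[of \<xi> w] that box(1) by blast
  have loglip': "norm (slope_map F p - slope_map F q) \<le> K * (\<epsilon> + ln (C / \<epsilon>) * norm (p - q))"
    if "p \<in> box a b" "q \<in> box a b" "\<And>k. k \<notin> range I \<Longrightarrow> p $ k = q $ k" "0 < \<epsilon>" "\<epsilon> < 1" for p q \<epsilon>
    using loglip[of p q \<epsilon>] that box(2) by blast
  have agree: "\<gamma>1 u = \<gamma>2 u" if "u \<in> ball ?base r" for u
    by (rule lifts_agree[OF J c Q K C below' lower loglip' lifts _ small that]) (simp_all add: r1(2) r2(2))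
  show "\<forall>\<^sub>F x in nhds x0. y x = z x"
  proof (rule eventually_mono[OF ev1[rule_format, OF conjI[OF r(1,2)]]], elim conjE)
    fix x
    let ?u = "coords J (join x (y x))"
    assume u: "?u \<in> ball ?base r" and eq: "\<gamma>1 ?u = join x (y x)"
    \<comment> \<open>The graph point of \<open>y\<close> over \<open>x\<close> thus also lies on
      the graph of \<open>z\<close>, over the same \<open>x\<close>.\<close>
    then have "\<gamma>2 ?u = join x (y x)" using agree by simp
    then show "y x = z x" using graph2[rule_format, OF subsetD[OF ball(2) u]] by simp
  qed
qed

end
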